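(* Let $a>0$, $-a<x_1\le a$, $V_1=(x_1,0)$, $V_2=(-a,0)$ and $V_3=V_3(t)=(a\cos t,a\sin t)$, $t\in[0,2\pi)$. The loci of the Brocard points $\Omega_1$ and $\Omega_2$ of the triangle $V_1V_2V_3(t)$ are a pair of (singular teardrop-shaped) closed curves with respective areas $$A_1=\frac{4\,(x_1+a)^2a^5\pi}{(3a^2+x_1^2)^2\sqrt{4a^2+x_1^2}},\qquad A_2=\frac{(2a^2-a x_1+x_1^2)\,(x_1+a)^3a^2\pi}{(3a^2+x_1^2)^2\sqrt{4a^2+x_1^2}}.$$
   Context: Brocard points: for the triangle with vertices $V_1,V_2,V_3$, here $\Omega_1$ denotes the unique interior point with $\angle\Omega_1V_2V_1=\angle\Omega_1V_1V_3=\angle\Omega_1V_3V_2$, and $\Omega_2$ the unique interior point with $\angle\Omega_2V_1V_2=\angle\Omega_2V_2V_3=\angle\Omega_2V_3V_1$. The names are assigned by the vertex labels and kept fixed as $V_3(t)$ moves. At the finitely many values of $t$ for which the triangle is degenerate, the Brocard points are understood as limits. "Singular teardrop" is only a descriptive term for the shape of the curves (and may degenerate for special $x_1$). The area of a closed curve is the absolute value of $\frac12\oint(x\,dy-y\,dx)$ over one revolution of $t$. *)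

theory Defs
  imports "HOL-Analysis.Analysis"
begin

type_synonym point = "real \<times> real"

definition vertex1 :: "real \<Rightarrow> point" where
  "vertex1 x1 = (x1, 0)"

definition vertex2 :: "real \<Rightarrow> point" where
  "vertex2 a = (- a, 0)"

definition vertex3 :: "real \<Rightarrow> real \<Rightarrow> point" where
  "vertex3 a t = (a * cos t, a * sin t)"

text \<open>The unoriented angle \<open>ABC\<close> at the vertex \<open>B\<close>, with values in \<open>[0, pi]\<close>.\<close>

definition angle :: "point \<Rightarrow> point \<Rightarrow> point \<Rightarrow> real" where
  "angle A B C = arccos (((A - B) \<bullet> (C - B)) / (norm (A - B) * norm (C - B)))"

definition is_brocard1 :: "point \<Rightarrow> point \<Rightarrow> point \<Rightarrow> point \<Rightarrow> bool" where
  "is_brocard1 V1 V2 V3 P \<longleftrightarrow>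
     P \<in> interior (convex hull {V1, V2, V3}) \<and>
     angle P V2 V1 = angle P V1 V3 \<and> angle P V1 V3 = angle P V3 V2"

definition is_brocard2 :: "point \<Rightarrow> point \<Rightarrow> point \<Rightarrow> point \<Rightarrow> bool" where
  "is_brocard2 V1 V2 V3 P \<longleftrightarrow>
     P \<in> interior (convex hull {V1, V2, V3}) \<and>
     angle P V1 V2 = angle P V2 V3 \<and> angle P V2 V3 = angle P V3 V1"

definition degenerate :: "real \<Rightarrow> real \<Rightarrow> real \<Rightarrow> bool" where
  "degenerate a x1 t \<longleftrightarrow> collinear {vertex1 x1, vertex2 a, vertex3 a t}"

text \<open>The functions \<open>brocard_pt1\<close> and \<open>brocard_pt2\<close> are meaningful only for non-degenerate triangles;
  \<open>Omega1\<close> and \<open>Omega2\<close> extend them to the degenerate parameters by limits.\<close>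

definition brocard_pt1 :: "real \<Rightarrow> real \<Rightarrow> real \<Rightarrow> point" where
  "brocard_pt1 a x1 t = (THE P. is_brocard1 (vertex1 x1) (vertex2 a) (vertex3 a t) P)"

definition brocard_pt2 :: "real \<Rightarrow> real \<Rightarrow> real \<Rightarrow> point" where
  "brocard_pt2 a x1 t = (THE P. is_brocard2 (vertex1 x1) (vertex2 a) (vertex3 a t) P)"

definition Omega1 :: "real \<Rightarrow> real \<Rightarrow> real \<Rightarrow> point" where
  "Omega1 a x1 t =
     (if degenerate a x1 t then Lim (at t) (brocard_pt1 a x1) else brocard_pt1 a x1 t)"

definition Omega2 :: "real \<Rightarrow> real \<Rightarrow> real \<Rightarrow> point" where
  "Omega2 a x1 t =
     (if degenerate a x1 t then Lim (at t) (brocard_pt2 a x1) else brocard_pt2 a x1 t)"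

definition locus :: "(real \<Rightarrow> point) \<Rightarrow> point set" where
  "locus \<Omega> = \<Omega> ` {0..<2 * pi}"

text \<open>One revolution of the parameter, rescaled to the unit interval on which library paths live.\<close>

definition revolution :: "(real \<Rightarrow> point) \<Rightarrow> real \<Rightarrow> point" where
  "revolution \<Omega> = \<Omega> \<circ> linepath 0 (2 * pi)"

text \<open>The absolute value of one half of the line integral of \<open>x dy - y dx\<close> along \<open>g\<close>.\<close>

definition curve_area :: "(real \<Rightarrow> point) \<Rightarrow> real" where
  "curve_area g =
     \<bar>1 / 2 * integral {0..1}
        (\<lambda>s. fst (g s) * snd (vector_derivative g (at s)) -
             snd (g s) * fst (vector_derivative g (at s)))\<bar>"

end

theory Submission
  imports Defs "HOL-Complex_Analysis.Cauchy_Integral_Formula"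
begin

text \<open>Let \<open>r\<close>, \<open>s\<close>, \<open>t\<close> be the squared sides opposite to the vertices \<open>A\<close>, \<open>B\<close>, \<open>C\<close>. The condition that the three
  angles of the first Brocard point agree is an equation between cotangents, which are rational in the barycentric
  weights. It has the unique positive solution \<open>r s : s t : t r\<close> (\<open>is_brocard1_iff\<close>). The second
  Brocard point is the first one of the triangle with two vertices exchanged. The formula remains continuous as long
  as two of the vertices differ, so it also yields the limits at degenerate triangles.

  In complex notation the Brocard point simplifies to \<open>B + v |u|\<^sup>2 / (|u|\<^sup>2 + |v|\<^sup>2 - u cnj v)\<close> with \<open>u = C - B\<close> and
  \<open>v = A - B\<close> (\<open>first_brocard_point_of\<close>). With the circle of radius 1, the first vertex at \<open>x\<close> and the moving vertex
  at \<open>z\<close> on the circle, this makes the two loci the images of the unit circle under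
  \<open>-1 + (1 + x) (1 + z)\<^sup>2 / (1 + p z - x z\<^sup>2)\<close> and
  \<open>x - (1 + x) (z - x) (1 - x z) / (z\<^sup>2 + p z - x)\<close>,
  where \<open>p = 2 + x + x\<^sup>2\<close>. Both denominators have one root inside and one outside the circle, possibly at infinity.

  The area enclosed by the image of the unit circle is half the imaginary part of the integral of \<open>cnj (f z) * f' z dz\<close>.
  As \<open>f\<close> has real coefficients, \<open>cnj (f z) = f (1 / z)\<close> on the circle, and Cauchy's formulas give, for
  \<open>f z = C + A z / (1 - \<rho> z) + B / (z - q)\<close>, the area
  \<open>\<pi> |(A / (1 - \<rho>\<^sup>2))\<^sup>2 - (B / (1 - q\<^sup>2))\<^sup>2|\<close> (\<open>two_pole_curve_area\<close>). What remains is to evaluate this with the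
  relations that hold between the poles (\<open>brocard_poles\<close>).\<close>

section \<open>The first Brocard point in barycentric coordinates\<close>

definition cross :: "point \<Rightarrow> point \<Rightarrow> real" where
  "cross u v = fst u * snd v - snd u * fst v"

lemma lagrange_identity_cross: "(u \<bullet> v)^2 + (cross u v)^2 = (norm u * norm v)^2"
  by (cases u, cases v)
    (simp add: cross_def norm_Pair power_mult_distrib algebra_simps power2_eq_square)

lemma collinear_iff_cross: "collinear {A, B, C} \<longleftrightarrow> cross (A - B) (C - B) = 0"
proof -
  have "collinear {A, B, C} \<longleftrightarrow> collinear {0, A - B, C - B}"
    by (auto simp: collinear_def)
  also have "\<dots> \<longleftrightarrow> \<bar>(A - B) \<bullet> (C - B)\<bar> = norm (A - B) * norm (C - B)"
    by (simp add: norm_cauchy_schwarz_equal)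
  also have "\<dots> \<longleftrightarrow> ((A - B) \<bullet> (C - B))^2 = (norm (A - B) * norm (C - B))^2"
    by (metis abs_ge_zero mult_nonneg_nonneg norm_ge_zero power2_abs power2_eq_iff_nonneg)
  also have "\<dots> \<longleftrightarrow> cross (A - B) (C - B) = 0"
    using lagrange_identity_cross[of "A - B" "C - B"] by auto
  finally show ?thesis .
qed

text \<open>The cotangent of an angle is the quotient of inner and cross product. Passing to it
  removes the square roots from the definition of the angle, and as
  \<^const>\<open>arctan\<close> is injective, equality of angles becomes equality of cotangents.\<close>

lemma angle_eq_arctan_cot:
  assumes "cross (A - B) (C - B) \<noteq> 0"
  shows "angle A B C = pi / 2 - arctan (((A - B) \<bullet> (C - B)) / \<bar>cross (A - B) (C - B)\<bar>)"
proof -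
  let ?d = "(A - B) \<bullet> (C - B)" and ?c = "\<bar>cross (A - B) (C - B)\<bar>"
  have c: "?c > 0" using assms by simp
  have "norm (A - B) * norm (C - B) = sqrt (?d^2 + ?c^2)"
    using lagrange_identity_cross[of "A - B" "C - B"]
    by (simp add: real_sqrt_unique)
  also have "?d^2 + ?c^2 = ?c^2 * (1 + (?d / ?c)^2)"
    using c by (simp add: field_simps)
  also have "sqrt \<dots> = ?c * sqrt (1 + (?d / ?c)^2)"
    by (simp add: real_sqrt_mult)
  finally have "angle A B C = arccos (sin (arctan (?d / ?c)))"
    by (simp add: angle_def sin_arctan)
  also have "\<dots> = arccos (cos (pi / 2 - arctan (?d / ?c)))"
    by (simp add: cos_diff)
  also have "\<dots> = pi / 2 - arctan (?d / ?c)"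
    using arctan_lbound[of "?d / ?c"] arctan_ubound[of "?d / ?c"]
    by (intro arccos_cos) auto
  finally show ?thesis .
qed

text \<open>For a point with barycentric weights \<open>\<alpha>\<close>, \<open>\<gamma>\<close> at \<open>A\<close>, \<open>C\<close>, the cross product
  with a side is the weight of the opposite vertex times twice the area of the triangle. The law of cosines
  turns the remaining inner product into side lengths, so the cotangent depends on nothing but
  the squared sides, the weights and the area, and the area is the same at all three vertices.\<close>

lemma angle_in_triangle:
  fixes A B C P :: point
  assumes "P - B = \<alpha> *\<^sub>R (A - B) + \<gamma> *\<^sub>R (C - B)" and "\<gamma> > 0"
    and "cross (A - B) (C - B) \<noteq> 0"
  shows "angle P B A = pi / 2 - arctan (((\<alpha> * (norm (A - B))^2) / \<gamma> +
      ((norm (A - B))^2 + (norm (C - B))^2 - (norm (A - C))^2) / 2) / \<bar>cross (A - B) (C - B)\<bar>)"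
proof -
  have c: "cross (P - B) (A - B) = - \<gamma> * cross (A - B) (C - B)"
    unfolding assms(1) by (simp add: cross_def algebra_simps)
  have "(P - B) \<bullet> (A - B) = \<alpha> * (norm (A - B))^2 + \<gamma> * ((A - B) \<bullet> (C - B))"
    unfolding assms(1) by (simp add: inner_add_left dot_square_norm inner_commute[of "C - B" "A - B"])
  also have "(A - B) \<bullet> (C - B) = ((norm (A - B))^2 + (norm (C - B))^2 - (norm (A - C))^2) / 2"
    using dot_norm_neg[of "A - B" "C - B"] by simp
  finally have d: "(P - B) \<bullet> (A - B) = \<alpha> * (norm (A - B))^2 +
     \<gamma> * (((norm (A - B))^2 + (norm (C - B))^2 - (norm (A - C))^2) / 2)" .
  have "cross (P - B) (A - B) \<noteq> 0" using c assms by simp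
  then show ?thesis
    unfolding angle_eq_arctan_cot[OF \<open>cross (P - B) (A - B) \<noteq> 0\<close>] c d
    using assms(2,3)
    by (simp add: abs_mult field_simps)
qed

text \<open>Monotonicity of a product of positive factors; this is what makes the Brocard point
  unique.\<close>

lemma eq_zero_if_prod_shift_eq:
  fixes r s t e :: real
  assumes "r > 0" "s > 0" "t > 0" "r + e > 0" "s + e > 0" "t + e > 0"
    and eq: "(r + e) * (s + e) * (t + e) = r * s * t"
  shows "e = 0"
proof (rule ccontr)
  assume "e \<noteq> 0"
  then consider "e > 0" | "e < 0" by linarith
  then show False
  proof cases
    case 1
    then have "r * s * t < (r + e) * (s + e) * (t + e)"
      using assms by (intro mult_strict_mono) auto
    with eq show False by simp
  next
    case 2
    then have "(r + e) * (s + e) * (t + e) < r * s * t"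
      using assms by (intro mult_strict_mono) auto
    with eq show False by simp
  qed
qed

text \<open>The common denominator of the barycentric coordinates. It also equals \<open>4 \<Delta>\<^sup>2 / sin\<^sup>2 \<omega>\<close>
  for the area \<open>\<Delta>\<close> and the Brocard angle \<open>\<omega>\<close>.\<close>

definition brocard_weight :: "point \<Rightarrow> point \<Rightarrow> point \<Rightarrow> real" where
  "brocard_weight A B C = (norm (B - C))^2 * (norm (A - C))^2 + (norm (A - C))^2 * (norm (A - B))^2
     + (norm (A - B))^2 * (norm (B - C))^2"

definition first_brocard :: "point \<Rightarrow> point \<Rightarrow> point \<Rightarrow> point" where
  "first_brocard A B C = (1 / brocard_weight A B C) *\<^sub>R
     (((norm (B - C))^2 * (norm (A - C))^2) *\<^sub>R A + ((norm (A - C))^2 * (norm (A - B))^2) *\<^sub>R B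
      + ((norm (A - B))^2 * (norm (B - C))^2) *\<^sub>R C)"

text \<open>Each of the three expressions is a multiple of the cotangent of an angle of the Brocard
  configuration, with squared sides \<open>r\<close>, \<open>s\<close>, \<open>t\<close>. After subtracting \<open>(r + s + t) / 2\<close>, their common value
  \<open>e\<close> satisfies \<open>s + e = \<alpha> t / \<gamma>\<close>, \<open>r + e = \<gamma> s / \<beta>\<close>, \<open>t + e = \<beta> r / \<alpha>\<close>. The weights cancel in the
  product of these, which forces \<open>e = 0\<close>, and then the weights are proportional to \<open>1 / t\<close>, \<open>1 / r\<close>,
  \<open>1 / s\<close>.\<close>

lemma brocard_cot_equations:
  fixes r s t \<alpha> \<beta> \<gamma> :: real
  assumes pos: "r > 0" "s > 0" "t > 0" "\<alpha> > 0" "\<beta> > 0" "\<gamma> > 0" and sum: "\<alpha> + \<beta> + \<gamma> = 1"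
  shows "(\<alpha> * t / \<gamma> + (t + r - s) / 2 = \<gamma> * s / \<beta> + (s + t - r) / 2 \<and>
          \<gamma> * s / \<beta> + (s + t - r) / 2 = \<beta> * r / \<alpha> + (r + s - t) / 2) \<longleftrightarrow>
         \<alpha> = r * s / (r * s + s * t + t * r) \<and> \<beta> = s * t / (r * s + s * t + t * r) \<and>
         \<gamma> = t * r / (r * s + s * t + t * r)"
    (is "?L \<longleftrightarrow> ?R")
proof -
  let ?W = "r * s + s * t + t * r"
  have W: "?W > 0" using pos by (simp add: add_pos_pos)
  show ?thesis
  proof
    assume L: ?L
    define e where "e = \<alpha> * t / \<gamma> - s"
    have e: "s + e = \<alpha> * t / \<gamma>" "r + e = \<gamma> * s / \<beta>" "t + e = \<beta> * r / \<alpha>"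
      using L unfolding e_def by argo+
    have "(r + e) * (s + e) * (t + e) = r * s * t"
      unfolding e using pos by (simp add: field_simps)
    moreover have "r + e > 0" "s + e > 0" "t + e > 0"
      unfolding e using pos by auto
    ultimately have "e = 0"
      using eq_zero_if_prod_shift_eq pos by blast
    with e have "s * \<gamma> = \<alpha> * t" "r * \<beta> = \<gamma> * s" "t * \<alpha> = \<beta> * r"
      using pos by (auto simp: field_simps)
    then have "\<beta> = \<alpha> * t / r" "\<gamma> = \<alpha> * t / s"
      using pos by (auto simp: field_simps)
    moreover have "\<alpha> * ?W = r * s * (\<alpha> + \<beta> + \<gamma>)"
      using \<open>\<beta> = \<alpha> * t / r\<close> \<open>\<gamma> = \<alpha> * t / s\<close> pos by (simp add: field_simps)
    then have "\<alpha> * ?W = r * s"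
      using sum by simp
    then have "\<alpha> = r * s / ?W"
      using W by (simp add: field_simps)
    ultimately show ?R using pos by simp
  next
    assume R: ?R
    have "\<alpha> * t / \<gamma> = s" "\<gamma> * s / \<beta> = r" "\<beta> * r / \<alpha> = t"
      using W pos R by auto
    then show ?L by argo
  qed
qed

text \<open>Existence and uniqueness of the Brocard point at once: interior points of the triangle are
  those with positive weights, and for these the angle conditions are the cotangent equations.\<close>

lemma is_brocard1_iff:
  assumes nc: "\<not> collinear {A, B, C}"
  shows "is_brocard1 A B C P \<longleftrightarrow> P = first_brocard A B C"
proof -
  define r where "r = (norm (B - C))^2"
  define s where "s = (norm (A - C))^2"
  define t where "t = (norm (A - B))^2"
  define D where "D = \<bar>cross (A - B) (C - B)\<bar>"
  have ne: "A \<noteq> B" "B \<noteq> C" "A \<noteq> C" using nc by (auto simp: insert_commute)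
  have pos: "r > 0" "s > 0" "t > 0"
    using ne by (auto simp: r_def s_def t_def)
  have W: "brocard_weight A B C = r * s + s * t + t * r"
    by (simp add: brocard_weight_def r_def s_def t_def)
  have W0: "r * s + s * t + t * r > 0" using pos by (simp add: add_pos_pos)
  have D: "D > 0" using nc by (simp add: D_def collinear_iff_cross)
  have nrm: "(norm (B - A))^2 = t" "(norm (C - A))^2 = s" "(norm (C - B))^2 = r"
     "(norm (A - B))^2 = t" "(norm (A - C))^2 = s" "(norm (B - C))^2 = r"
    by (simp_all add: r_def s_def t_def norm_minus_commute)
  have crs: "\<bar>cross (C - A) (B - A)\<bar> = D" "\<bar>cross (B - C) (A - C)\<bar> = D"
    by (auto simp: D_def cross_def algebra_simps)
  have angles: "angle P B A = angle P A C \<and> angle P A C = angle P C B \<longleftrightarrow>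
      \<alpha> = r * s / (r * s + s * t + t * r) \<and> \<beta> = s * t / (r * s + s * t + t * r) \<and>
         \<gamma> = t * r / (r * s + s * t + t * r)"
    if w: "\<alpha> > 0" "\<beta> > 0" "\<gamma> > 0" "\<alpha> + \<beta> + \<gamma> = 1"
      and P: "\<alpha> *\<^sub>R A + \<beta> *\<^sub>R B + \<gamma> *\<^sub>R C = P" for \<alpha> \<beta> \<gamma>
  proof -
    have \<alpha>: "\<alpha> = 1 - \<beta> - \<gamma>" using w by simp
    have PB: "P - B = \<alpha> *\<^sub>R (A - B) + \<gamma> *\<^sub>R (C - B)"
      unfolding P[symmetric] \<alpha> by (simp add: algebra_simps)
    have PA: "P - A = \<gamma> *\<^sub>R (C - A) + \<beta> *\<^sub>R (B - A)"
      unfolding P[symmetric] \<alpha> by (simp add: algebra_simps)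
    have PC: "P - C = \<beta> *\<^sub>R (B - C) + \<alpha> *\<^sub>R (A - C)"
      unfolding P[symmetric] \<alpha> by (simp add: algebra_simps)
    have "angle P B A = pi / 2 - arctan ((\<alpha> * t / \<gamma> + (t + r - s) / 2) / D)"
      using angle_in_triangle[OF PB] w D by (simp add: nrm D_def)
    moreover have "angle P A C = pi / 2 - arctan ((\<gamma> * s / \<beta> + (s + t - r) / 2) / D)"
      using angle_in_triangle[OF PA] w D crs by (auto simp: nrm)
    moreover have "angle P C B = pi / 2 - arctan ((\<beta> * r / \<alpha> + (r + s - t) / 2) / D)"
      using angle_in_triangle[OF PC] w D crs by (auto simp: nrm)
    moreover have arctan_inj: "pi / 2 - arctan y = pi / 2 - arctan z \<longleftrightarrow> y = z" for y z :: real
      by (simp add: arctan_eq_iff)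
    ultimately have "angle P B A = angle P A C \<and> angle P A C = angle P C B \<longleftrightarrow>
        (\<alpha> * t / \<gamma> + (t + r - s) / 2) / D = (\<gamma> * s / \<beta> + (s + t - r) / 2) / D \<and>
        (\<gamma> * s / \<beta> + (s + t - r) / 2) / D = (\<beta> * r / \<alpha> + (r + s - t) / 2) / D"
      using arctan_inj by (metis (no_types))
    also have "\<dots> \<longleftrightarrow> \<alpha> * t / \<gamma> + (t + r - s) / 2 = \<gamma> * s / \<beta> + (s + t - r) / 2 \<and>
        \<gamma> * s / \<beta> + (s + t - r) / 2 = \<beta> * r / \<alpha> + (r + s - t) / 2"
      using D by (simp only: divide_cancel_right) blast
    finally show ?thesis
      using brocard_cot_equations[OF pos w] by simp
  qed
  have int: "P \<in> interior (convex hull {A, B, C}) \<longleftrightarrow>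
     (\<exists>\<alpha> \<beta> \<gamma>. 0 < \<alpha> \<and> 0 < \<beta> \<and> 0 < \<gamma> \<and> \<alpha> + \<beta> + \<gamma> = 1 \<and> \<alpha> *\<^sub>R A + \<beta> *\<^sub>R B + \<gamma> *\<^sub>R C = P)"
    using interior_convex_hull_3_minimal[OF nc] by simp
  have br: "first_brocard A B C = (r * s / (r * s + s * t + t * r)) *\<^sub>R A +
     (s * t / (r * s + s * t + t * r)) *\<^sub>R B + (t * r / (r * s + s * t + t * r)) *\<^sub>R C"
    unfolding first_brocard_def W unfolding nrm by (simp add: algebra_simps)
  show ?thesis
  proof
    assume "is_brocard1 A B C P"
    then show "P = first_brocard A B C"
      unfolding is_brocard1_def int br using angles by blast
  next
    assume P: "P = first_brocard A B C"
    have w: "r * s / (r * s + s * t + t * r) > 0" "s * t / (r * s + s * t + t * r) > 0"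
      "t * r / (r * s + s * t + t * r) > 0"
      "r * s / (r * s + s * t + t * r) + s * t / (r * s + s * t + t * r) +
       t * r / (r * s + s * t + t * r) = 1"
      using pos W0 by (auto simp: add_divide_distrib[symmetric])
    show "is_brocard1 A B C P"
      unfolding is_brocard1_def int using w br angles[OF w] P by metis
  qed
qed

text \<open>Exchanging the first two vertices reverses the orientation of the triangle and thereby
  exchanges the two Brocard points, so one formula serves for both.\<close>

lemma is_brocard2_iff_swap: "is_brocard2 A B C P \<longleftrightarrow> is_brocard1 B A C P"
  by (simp add: is_brocard1_def is_brocard2_def insert_commute)

text \<open>Two distinct vertices suffice: the formula for the Brocard point stays
  meaningful, and continuous, when the triangle degenerates.\<close>

lemma brocard_weight_pos:
  assumes "A \<noteq> B"
  shows "brocard_weight A B C > 0"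
proof -
  have AB: "norm (A - B) > 0" using assms by simp
  have "norm (A - C) \<noteq> 0 \<or> norm (B - C) \<noteq> 0" using assms by auto
  then have "0 < (norm (A - C))^2 + (norm (B - C))^2"
    by (simp only: sum_power2_gt_zero_iff)
  then have "0 < (norm (B - C))^2 * (norm (A - C))^2 +
      (norm (A - B))^2 * ((norm (A - C))^2 + (norm (B - C))^2)"
    using AB by (intro add_nonneg_pos[OF _ mult_pos_pos]) auto
  also have "\<dots> = brocard_weight A B C"
    by (simp add: brocard_weight_def algebra_simps)
  finally show ?thesis .
qed

section \<open>The Brocard point as a complex number\<close>

definition point_of :: "complex \<Rightarrow> point" where
  "point_of w = (Re w, Im w)"

lemma bounded_linear_point_of: "bounded_linear point_of"
  unfolding point_of_def [abs_def] by (intro bounded_linear_Pair bounded_linear_Re bounded_linear_Im)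

lemma point_of_add: "point_of (z + w) = point_of z + point_of w"
  and point_of_diff: "point_of (z - w) = point_of z - point_of w"
  and point_of_scaleR: "point_of (k *\<^sub>R z) = k *\<^sub>R point_of z"
  by (simp_all add: point_of_def)

lemma norm_point_of: "norm (point_of w) = cmod w"
  by (simp add: point_of_def norm_Pair cmod_def)

text \<open>The Brocard weight is \<open>Q\<close> times its conjugate, and the numerator of the barycentric
  formula, taken relative to \<open>B\<close>, contains the factor \<^term>\<open>cnj Q\<close>. Cancelling it halves the degree of the
  denominator; it is the reason why the loci are images of the unit circle under rational
  functions of degree two.\<close>

lemma first_brocard_point_of:
  fixes A B C :: complex
  defines "u \<equiv> C - B" and "v \<equiv> A - B"
  defines "Q \<equiv> u * cnj u + v * cnj v - u * cnj v"
  assumes ne: "A \<noteq> B"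
  shows "Q \<noteq> 0" and "first_brocard (point_of A) (point_of B) (point_of C) = point_of (B + v * (u * cnj u) / Q)"
proof -
  define r s t where "r = (cmod (B - C))^2" and "s = (cmod (A - C))^2" and "t = (cmod (A - B))^2"
  define W where "W = brocard_weight (point_of A) (point_of B) (point_of C)"
  have rst: "of_real r = u * cnj u" "of_real s = (u - v) * cnj (u - v)" "of_real t = v * cnj v"
    unfolding r_def s_def t_def u_def v_def complex_norm_square by (simp_all add: algebra_simps)
  have dist: "(norm (point_of B - point_of C))^2 = r" "(norm (point_of A - point_of C))^2 = s"
     "(norm (point_of A - point_of B))^2 = t"
    by (simp_all add: r_def s_def t_def norm_point_of flip: point_of_diff)
  have "W = r * s + s * t + t * r"
    unfolding W_def brocard_weight_def dist ..
  then have W: "of_real W = Q * cnj Q"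
    unfolding Q_def by (simp add: rst algebra_simps)
  have "W \<noteq> 0"
    using brocard_weight_pos[of "point_of A" "point_of B" "point_of C"] ne
    by (auto simp: W_def point_of_def complex_eq_iff)
  then show Q: "Q \<noteq> 0"
    using W by auto
  have A: "A = B + v" and C: "C = B + u" by (simp_all add: u_def v_def)
  have "of_real (r * s) * A + of_real (s * t) * B + of_real (t * r) * C =
        of_real W * B + v * (u * cnj u) * cnj Q"
    unfolding W Q_def A C by (simp add: rst algebra_simps)
  then have "(of_real (r * s) * A + of_real (s * t) * B + of_real (t * r) * C) / of_real W =
        B + v * (u * cnj u) / Q"
    using Q unfolding W by (simp add: field_simps)
  moreover have "first_brocard (point_of A) (point_of B) (point_of C) =
      (1 / W) *\<^sub>R ((r * s) *\<^sub>R point_of A + (s * t) *\<^sub>R point_of B + (t * r) *\<^sub>R point_of C)"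
    unfolding first_brocard_def dist W_def ..
  then have "first_brocard (point_of A) (point_of B) (point_of C) =
      point_of ((1 / W) *\<^sub>R ((r * s) *\<^sub>R A + (s * t) *\<^sub>R B + (t * r) *\<^sub>R C))"
    by (simp only: point_of_scaleR point_of_add)
  ultimately show "first_brocard (point_of A) (point_of B) (point_of C) = point_of (B + v * (u * cnj u) / Q)"
    by (simp add: scaleR_conv_of_real)
qed

section \<open>The area enclosed by a rational image of the unit circle\<close>

text \<open>With \<open>x + i y = f z\<close>, the form \<open>x dy - y dx\<close> is the imaginary part of
  \<open>cnj (f z) * f' z dz\<close>.\<close>

lemma circle_image_curve:
  fixes f :: "complex \<Rightarrow> complex"
  assumes f: "f holomorphic_on S" and S: "open S" "sphere 0 1 \<subseteq> S"
  defines "g \<equiv> \<lambda>s. point_of (f (circlepath 0 1 s))"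
  shows "valid_path g" and "closed_path g"
    and "curve_area g =
      \<bar>Im (contour_integral (circlepath 0 1) (\<lambda>z. cnj (f z) * deriv f z)) / 2\<bar>"
proof -
  define c where "c = circlepath 0 1"
  define c' where "c' = (\<lambda>s. 2 * pi * \<i> * exp (2 * of_real pi * \<i> * of_real s))"
  have c': "(c has_vector_derivative c' s) (at s)" for s
    unfolding c_def c'_def using has_vector_derivative_circlepath[of 0 1 s UNIV] by simp
  have cS: "c s \<in> S" for s
    using S(2) by (auto simp: c_def circlepath subset_eq simp flip: mult.assoc)
  have fc: "((\<lambda>s. f (c s)) has_vector_derivative c' s * deriv f (c s)) (at s)" for s
    using field_vector_diff_chain_at[OF c' holomorphic_derivI[OF f S(1) cS]] by (simp add: o_def)
  have g': "(g has_vector_derivative point_of (c' s * deriv f (c s))) (at s)" for s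
    unfolding g_def c_def[symmetric]
    by (rule bounded_linear.has_vector_derivative[OF bounded_linear_point_of fc])
  have cont_c: "continuous_on X c" for X
    by (intro continuous_at_imp_continuous_on ballI vector_derivative_works[THEN iffD2, THEN differentiable_imp_continuous_within] )
      (metis c' vector_derivative_at)
  have cont_df: "continuous_on X (\<lambda>s. deriv f (c s))" for X
    by (rule continuous_on_compose2[OF holomorphic_on_imp_continuous_on[OF holomorphic_deriv[OF f S(1)]] cont_c])
      (use cS in auto)
  have cont_f: "continuous_on X (\<lambda>s. f (c s))" for X
    by (rule continuous_on_compose2[OF holomorphic_on_imp_continuous_on[OF f] cont_c])
      (use cS in auto)
  have cont_c': "continuous_on X c'" for X
    unfolding c'_def by (intro continuous_intros)
  have "continuous_on {0..1} (\<lambda>s. point_of (c' s * deriv f (c s)))"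
    by (intro bounded_linear.continuous_on[OF bounded_linear_point_of] continuous_intros cont_df cont_c')
  then show "valid_path g"
    unfolding valid_path_def using g'
    by (intro C1_differentiable_imp_piecewise) (auto simp: C1_differentiable_on_def
      intro!: exI[of _ "\<lambda>s. point_of (c' s * deriv f (c s))"])
  show "closed_path g"
    unfolding closed_path_def g_def circlepath by simp
  let ?h = "\<lambda>s. cnj (f (c s)) * deriv f (c s) * c' s"
  have "integral {0..1} (\<lambda>s. fst (g s) * snd (vector_derivative g (at s)) -
             snd (g s) * fst (vector_derivative g (at s))) = integral {0..1} (\<lambda>s. Im (?h s))"
    unfolding vector_derivative_at[OF g']
    by (simp add: g_def point_of_def c_def algebra_simps)
  also have "\<dots> = Im (integral {0..1} ?h)"
  proof -
    have "?h integrable_on {0..1}"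
      by (intro integrable_continuous_real continuous_intros cont_f cont_df cont_c')
    then show ?thesis
      using integral_linear[OF _ bounded_linear_Im, of ?h "{0..1}"] by (simp add: o_def)
  qed
  also have "integral {0..1} ?h = contour_integral (circlepath 0 1) (\<lambda>z. cnj (f z) * deriv f z)"
    unfolding contour_integral_integral vector_derivative_at[OF c'] c_def[symmetric] ..
  finally show "curve_area g =
      \<bar>Im (contour_integral (circlepath 0 1) (\<lambda>z. cnj (f z) * deriv f z)) / 2\<bar>"
    by (simp add: curve_area_def)
qed

text \<open>On the unit circle \<^term>\<open>cnj z\<close> is \<open>1 / z\<close>, so for a rational function \<open>f\<close> with real
  coefficients the integrand \<open>cnj (f z) * f' z\<close> is the rational function \<open>f (1 / z) * f' z\<close>, and the integral is a sum of residues. The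
  part of \<open>f\<close> that is holomorphic inside the circle runs counterclockwise and contributes positively, the part
  with its pole inside runs clockwise and contributes negatively; the mixed terms integrate to zero.
  Writing the outer pole as \<open>1 / \<rho>\<close> includes the case \<open>\<rho> = 0\<close> of a pole at infinity.\<close>

lemma two_pole_curve_area:
  fixes A B C \<rho> q :: real and f :: "complex \<Rightarrow> complex"
  assumes \<rho>: "\<bar>\<rho>\<bar> < 1" and q: "\<bar>q\<bar> < 1" and ne: "\<rho> \<noteq> q"
  defines "f \<equiv> \<lambda>z. of_real C + of_real A * z / (1 - of_real \<rho> * z) + of_real B / (z - of_real q)"
  shows "valid_path (\<lambda>s. point_of (f (circlepath 0 1 s)))"
    and "closed_path (\<lambda>s. point_of (f (circlepath 0 1 s)))"
    and "curve_area (\<lambda>s. point_of (f (circlepath 0 1 s))) =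
       pi * \<bar>(A / (1 - \<rho>^2))^2 - (B / (1 - q^2))^2\<bar>"
proof -
  define S where "S = {z. 1 - of_real \<rho> * z \<noteq> 0} \<inter> (- {complex_of_real q})"
  have S: "open S"
    unfolding S_def by (intro open_Int open_Collect_neq continuous_intros open_Compl)
  have nz: "1 - of_real r * z \<noteq> 0" if "\<bar>r\<bar> < 1" "cmod z \<le> 1" for r :: real and z
  proof
    assume "1 - of_real r * z = 0"
    then have "1 = cmod (of_real r * z)" by simp
    also have "\<dots> < 1" using that mult_left_mono[of "cmod z" 1 "\<bar>r\<bar>"] by (simp add: norm_mult)
    finally show False by simp
  qed
  have nq: "z \<noteq> of_real r" if "\<bar>r\<bar> < 1" "cmod z = 1" for r :: real and z
    using that by auto
  have sub: "sphere 0 1 \<subseteq> S"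
    using nz[OF \<rho>] q by (auto simp: S_def)
  have deriv_f: "(f has_field_derivative (of_real A / (1 - of_real \<rho> * z)^2
      - of_real B / (z - of_real q)^2)) (at z)" if "z \<in> S" for z
    using that unfolding f_def S_def
    by (auto intro!: derivative_eq_intros simp: field_simps power2_eq_square)
  have hol: "f holomorphic_on S"
    using deriv_f S holomorphic_on_open by blast
  note curve = circle_image_curve[OF hol S sub]
  show "valid_path (\<lambda>s. point_of (f (circlepath 0 1 s)))"
    and "closed_path (\<lambda>s. point_of (f (circlepath 0 1 s)))"
    using curve(1,2) by auto
  define \<delta> where "\<delta> = complex_of_real (\<rho> - q)"
  have \<delta>: "\<delta> \<noteq> 0" using ne by (simp add: \<delta>_def)
  \<comment> \<open>These functions are holomorphic on the closed disc. They collect the terms of the integrand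
    by their poles, the product of both poles having been split into partial fractions.\<close>
  define H0 where "H0 = (\<lambda>z::complex. of_real (C * A) / (1 - of_real \<rho> * z)^2
      + of_real (A * B) * z / ((1 - of_real q * z) * (1 - of_real \<rho> * z)^2))"
  define H1 where "H1 = (\<lambda>z::complex. of_real (A^2) / (1 - of_real \<rho> * z)^2 - of_real (A * B) / \<delta>^2)"
  define H2 where "H2 = (\<lambda>z::complex. of_real (A * B) / \<delta> - of_real (C * B)
      - of_real (B^2) * z / (1 - of_real q * z))"
  have "((\<lambda>z. H0 z) has_contour_integral 0) (circlepath 0 1)"
    by (rule Cauchy_theorem_convex_simple[where S = "cball 0 1"])
      (use nz[OF \<rho>] nz[OF q] in \<open>auto simp: H0_def intro!: holomorphic_intros\<close>)
  moreover have "((\<lambda>z. H1 z / (z - of_real \<rho>)) has_contour_integral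
      2 * of_real pi * \<i> * H1 (of_real \<rho>)) (circlepath 0 1)"
    by (rule Cauchy_integral_circlepath_simple)
      (use nz[OF \<rho>] \<rho> in \<open>auto simp: H1_def intro!: holomorphic_intros\<close>)
  moreover have "((\<lambda>z. (of_real (A * B) / \<delta>^2) / (z - of_real q)) has_contour_integral
      2 * of_real pi * \<i> * (of_real (A * B) / \<delta>^2)) (circlepath 0 1)"
    by (rule Cauchy_integral_circlepath_simple) (use q in auto)
  moreover have "((\<lambda>z. H2 z / (z - of_real q)^2) has_contour_integral
      2 * of_real pi * \<i> * (- of_real (B^2) / (1 - of_real q^2)^2)) (circlepath 0 1)"
  proof -
    have holH2: "H2 holomorphic_on cball 0 1"
      using nz[OF q] by (auto simp: H2_def intro!: holomorphic_intros)
    have "deriv H2 (of_real q) = - of_real (B^2) / (1 - of_real q^2)^2"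
      unfolding H2_def using nz[OF q, of "of_real q"] q
      by (intro DERIV_imp_deriv) (auto intro!: derivative_eq_intros simp: field_simps power2_eq_square)
    moreover have "((\<lambda>z. H2 z / (z - of_real q) ^ Suc 1) has_contour_integral
      (2 * pi * \<i>) / fact 1 * (deriv ^^ 1) H2 (of_real q)) (circlepath 0 1)"
      using q holH2
      by (intro Cauchy_has_contour_integral_higher_derivative_circlepath)
        (auto intro: holomorphic_on_imp_continuous_on holomorphic_on_subset)
    ultimately show ?thesis by (simp add: numeral_2_eq_2)
  qed
  ultimately have int: "((\<lambda>z. H0 z + H1 z / (z - of_real \<rho>) + (of_real (A * B) / \<delta>^2) / (z - of_real q)
      + H2 z / (z - of_real q)^2) has_contour_integral
     (0 + 2 * of_real pi * \<i> * H1 (of_real \<rho>) + 2 * of_real pi * \<i> * (of_real (A * B) / \<delta>^2)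
      + 2 * of_real pi * \<i> * (- of_real (B^2) / (1 - of_real q^2)^2))) (circlepath 0 1)"
    by (intro has_contour_integral_add)
  have eq: "cnj (f z) * deriv f z = H0 z + H1 z / (z - of_real \<rho>)
      + (of_real (A * B) / \<delta>^2) / (z - of_real q) + H2 z / (z - of_real q)^2"
    if "z \<in> path_image (circlepath 0 1)" for z
  proof -
    have z: "cmod z = 1" using that by simp
    have z0: "z \<noteq> 0" using z by auto
    have cnj_z: "cnj z = 1 / z"
      using z z0 complex_norm_square[of z] by (simp add: field_simps)
    have f1: "cnj (f z) = of_real C + of_real A * (1 / (z - of_real \<rho>)) + of_real B * (z / (1 - of_real q * z))"
    proof -
      have "cnj z / (1 - of_real \<rho> * cnj z) = 1 / (z - of_real \<rho>)"
        using z0 nq[OF \<rho> z] by (simp add: cnj_z field_simps)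
      moreover have "1 / (cnj z - of_real q) = z / (1 - of_real q * z)"
        using z0 nz[OF q, of z] z by (simp add: cnj_z field_simps)
      ultimately show ?thesis
        unfolding f_def by (simp add: divide_inverse mult.assoc)
    qed
    have f2: "deriv f z = of_real A * (1 / (1 - of_real \<rho> * z)^2) - of_real B * (1 / (z - of_real q)^2)"
      using DERIV_imp_deriv[OF deriv_f] sub z by (auto simp: subset_eq)
    define a where "a = 1 / (z - of_real \<rho>)"
    define b where "b = 1 / (z - of_real q)"
    define m where "m = 1 / (1 - of_real \<rho> * z)"
    define n where "n = 1 / (1 - of_real q * z)"
    \<comment> \<open>The partial fraction decomposition of \<open>a * b\<^sup>2\<close>.\<close>
    have "a - b = \<delta> * a * b"
      using nq[OF \<rho> z] nq[OF q z] by (simp add: a_def b_def \<delta>_def field_simps)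
    then have "\<delta>^2 * (a * b^2) = a - b - \<delta> * b^2"
      by algebra
    then have "a * b^2 = (a - b - \<delta> * b^2) / \<delta>^2"
      using \<delta> by (simp add: eq_divide_eq mult.commute)
    then have p: "a * b^2 = 1 / \<delta>^2 * a - 1 / \<delta>^2 * b - 1 / \<delta> * b^2"
      using \<delta> by (simp add: diff_divide_distrib power2_eq_square)
    have "cnj (f z) * deriv f z = (of_real C + of_real A * a + of_real B * (z * n))
        * (of_real A * m^2 - of_real B * b^2)"
      unfolding f1 f2 a_def b_def m_def n_def by (simp add: power_divide)
    also have "\<dots> = of_real (C * A) * m^2 + of_real (A * B) * z * n * m^2
        + of_real (A^2) * m^2 * a - of_real (C * B) * b^2 - of_real (B^2) * z * n * b^2
        - of_real (A * B) * (a * b^2)"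
      by (simp add: algebra_simps power2_eq_square)
    also have "\<dots> = H0 z + H1 z * a + (of_real (A * B) / \<delta>^2) * b + H2 z * b^2"
      unfolding p H0_def H1_def H2_def m_def n_def by (simp add: power_divide algebra_simps)
    finally show ?thesis
      unfolding a_def b_def by (simp add: power_divide)
  qed
  have "contour_integral (circlepath 0 1) (\<lambda>z. cnj (f z) * deriv f z) =
      2 * of_real pi * \<i> * H1 (of_real \<rho>) + 2 * of_real pi * \<i> * (of_real (A * B) / \<delta>^2)
      + 2 * of_real pi * \<i> * (- of_real (B^2) / (1 - of_real q^2)^2)"
  proof -
    have "((\<lambda>z. cnj (f z) * deriv f z) has_contour_integral
     (0 + 2 * of_real pi * \<i> * H1 (of_real \<rho>) + 2 * of_real pi * \<i> * (of_real (A * B) / \<delta>^2)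
      + 2 * of_real pi * \<i> * (- of_real (B^2) / (1 - of_real q^2)^2))) (circlepath 0 1)"
      by (rule has_contour_integral_eq[OF int]) (rule eq[symmetric])
    then show ?thesis by (simp add: contour_integral_unique)
  qed
  also have "\<dots> = of_real (2 * pi * ((A / (1 - \<rho>^2))^2 - (B / (1 - q^2))^2)) * \<i>"
    by (simp add: H1_def power_divide algebra_simps flip: power2_eq_square)
  finally show "curve_area (\<lambda>s. point_of (f (circlepath 0 1 s))) =
       pi * \<bar>(A / (1 - \<rho>^2))^2 - (B / (1 - q^2))^2\<bar>"
    unfolding curve(3) by (simp add: abs_mult)
qed

lemma partial_fractions_two_poles:
  fixes z \<rho> q l m n :: "'a :: field"
  assumes "1 - \<rho> * z \<noteq> 0" "z - q \<noteq> 0" "1 - \<rho> * q \<noteq> 0"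
  shows "(l + m * z + n * z^2) / ((1 - \<rho> * z) * (z - q)) =
    (m + n * q + l * \<rho>) / (1 - \<rho> * q) +
    (n + m * \<rho> + l * \<rho>^2) / (1 - \<rho> * q) * z / (1 - \<rho> * z) +
    (l + m * q + n * q^2) / (1 - \<rho> * q) / (z - q)"
proof -
  define c where "c = m + n * q + l * \<rho>"
  define \<alpha> where "\<alpha> = n + m * \<rho> + l * \<rho>^2"
  define \<beta> where "\<beta> = l + m * q + n * q^2"
  have "(l + m * z + n * z^2) * (1 - \<rho> * q) =
     c * ((1 - \<rho> * z) * (z - q)) + \<alpha> * z * (z - q) + \<beta> * (1 - \<rho> * z)"
    by (simp add: c_def \<alpha>_def \<beta>_def algebra_simps power2_eq_square)
  then have "(l + m * z + n * z^2) / ((1 - \<rho> * z) * (z - q)) =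
     (c * ((1 - \<rho> * z) * (z - q)) + \<alpha> * z * (z - q) + \<beta> * (1 - \<rho> * z))
     / ((1 - \<rho> * q) * ((1 - \<rho> * z) * (z - q)))"
    using assms by (simp add: frac_eq_eq)
  also have "\<dots> = c / (1 - \<rho> * q) + \<alpha> / (1 - \<rho> * q) * z / (1 - \<rho> * z) + \<beta> / (1 - \<rho> * q) / (z - q)"
    using assms by (simp add: add_divide_distrib)
  finally show ?thesis unfolding c_def \<alpha>_def \<beta>_def .
qed

text \<open>The form in which the Brocard loci occur. By partial fractions, the residues at the poles are the values of the
  quadratic numerator at the inner pole and of the reversed numerator at the outer one, up to a common factor.\<close>

lemma quadratic_fraction_curve_area:
  fixes l m n K D \<rho> q :: real and f :: "complex \<Rightarrow> complex"
  assumes \<rho>: "\<bar>\<rho>\<bar> < 1" and q: "\<bar>q\<bar> < 1" and ne: "\<rho> \<noteq> q"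
    and f: "\<And>z. cmod z = 1 \<Longrightarrow> f z = of_real D + of_real K *
        ((of_real l + of_real m * z + of_real n * z^2) / ((1 - of_real \<rho> * z) * (z - of_real q)))"
    and g: "\<And>s. g s = point_of (f (cis (2 * pi * s)))"
  shows "valid_path g" and "closed_path g"
    and "curve_area g = pi * (K / (1 - \<rho> * q))^2 *
       \<bar>((n + m * \<rho> + l * \<rho>^2) / (1 - \<rho>^2))^2 - ((l + m * q + n * q^2) / (1 - q^2))^2\<bar>"
proof -
  define k where "k = 1 - \<rho> * q"
  have "\<bar>\<rho> * q\<bar> < 1" using mult_strict_mono[OF \<rho> q] by (simp add: abs_mult)
  then have k: "k \<noteq> 0" by (auto simp: k_def)
  define A where "A = K * ((n + m * \<rho> + l * \<rho>^2) / k)"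
  define B where "B = K * ((l + m * q + n * q^2) / k)"
  define C where "C = D + K * ((m + n * q + l * \<rho>) / k)"
  have eq: "f z = of_real C + of_real A * z / (1 - of_real \<rho> * z) + of_real B / (z - of_real q)"
    if z: "cmod z = 1" for z
  proof -
    have 1: "1 - of_real \<rho> * z \<noteq> 0"
    proof
      assume "1 - of_real \<rho> * z = 0"
      then have "cmod (of_real \<rho> * z) = 1" by simp
      then show False using \<rho> z by (simp add: norm_mult)
    qed
    have 2: "z - of_real q \<noteq> 0" using q z by auto
    have 3: "1 - of_real \<rho> * of_real q \<noteq> (0 :: complex)"
      using k unfolding k_def by (metis of_real_1 of_real_diff of_real_eq_0_iff of_real_mult)
    show ?thesis
      unfolding f[OF z] partial_fractions_two_poles[OF 1 2 3]
      by (simp add: A_def B_def C_def k_def algebra_simps)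
  qed
  have "g = (\<lambda>s. point_of (of_real C + of_real A * circlepath 0 1 s / (1 - of_real \<rho> * circlepath 0 1 s)
      + of_real B / (circlepath 0 1 s - of_real q)))"
  proof
    fix s
    have "circlepath 0 1 s = cis (2 * pi * s)"
      by (simp add: circlepath cis_conv_exp algebra_simps)
    then show "g s = point_of (of_real C + of_real A * circlepath 0 1 s / (1 - of_real \<rho> * circlepath 0 1 s)
      + of_real B / (circlepath 0 1 s - of_real q))"
      using g eq[of "cis (2 * pi * s)"] by simp
  qed
  note * = two_pole_curve_area[OF \<rho> q ne, of C A B, folded this]
  show "valid_path g" "closed_path g" using * by auto
  have "A / (1 - \<rho>^2) = K / k * ((n + m * \<rho> + l * \<rho>^2) / (1 - \<rho>^2))"
    and "B / (1 - q^2) = K / k * ((l + m * q + n * q^2) / (1 - q^2))"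
    by (simp_all add: A_def B_def)
  then have "curve_area g = pi * \<bar>(K / k)^2 * (((n + m * \<rho> + l * \<rho>^2) / (1 - \<rho>^2))^2
      - ((l + m * q + n * q^2) / (1 - q^2))^2)\<bar>"
    using *(3) by (simp only: power_mult_distrib right_diff_distrib)
  then show "curve_area g = pi * (K / (1 - \<rho> * q))^2 *
       \<bar>((n + m * \<rho> + l * \<rho>^2) / (1 - \<rho>^2))^2 - ((l + m * q + n * q^2) / (1 - q^2))^2\<bar>"
    unfolding abs_mult k_def by simp
qed

section \<open>The moving vertex and the degenerate triangles\<close>

lemma degenerate_iff:
  assumes "a > 0" "x1 \<noteq> - a"
  shows "degenerate a x1 t \<longleftrightarrow> sin t = 0"
  using assms unfolding degenerate_def collinear_iff_cross
  by (auto simp: cross_def vertex1_def vertex2_def vertex3_def)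

lemma eventually_sin_nonzero: "\<forall>\<^sub>F s in at t. sin s \<noteq> (0::real)"
proof (cases "sin t = 0")
  case True
  then obtain j :: int where j: "t = j * pi" by (auto simp: sin_zero_iff_int2)
  have "sin s \<noteq> 0" if "s \<noteq> t" "dist s t < pi" for s
  proof
    assume "sin s = 0"
    then obtain i :: int where i: "s = i * pi" by (auto simp: sin_zero_iff_int2)
    then have "\<bar>real_of_int (i - j)\<bar> * pi < 1 * pi"
      using that(2) by (simp add: j dist_real_def abs_mult flip: left_diff_distrib)
    then have "\<bar>real_of_int (i - j)\<bar> < 1" by (simp only: mult_less_cancel_right_pos pi_gt_zero)
    then have "i = j" by linarith
    with that(1) i j show False by simp
  qed
  then show ?thesis unfolding eventually_at by (intro exI[of _ pi]) auto
next
  case False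
  have "(sin \<longlongrightarrow> sin t) (at t)" by (intro tendsto_intros)
  then show ?thesis using tendsto_imp_eventually_ne False by blast
qed

lemma tendsto_first_brocard_vertex3:
  assumes "A \<noteq> B"
  shows "((\<lambda>s. first_brocard A B (vertex3 a s)) \<longlongrightarrow> first_brocard A B (vertex3 a t)) (at t)"
proof -
  have V: "(vertex3 a \<longlongrightarrow> vertex3 a t) (at t)"
    unfolding vertex3_def by (intro tendsto_intros)
  have "brocard_weight A B (vertex3 a t) \<noteq> 0"
    using brocard_weight_pos[OF assms] by (simp add: less_imp_neq[symmetric])
  moreover have "((\<lambda>s. brocard_weight A B (vertex3 a s)) \<longlongrightarrow> brocard_weight A B (vertex3 a t)) (at t)"
    unfolding brocard_weight_def by (intro tendsto_intros V)
  ultimately show ?thesis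
    unfolding first_brocard_def by (intro tendsto_intros V)
qed

text \<open>The barycentric formula is continuous in the moving vertex, even where the triangle
  degenerates, and degenerate parameters are isolated. Hence the limits exist and are given by the
  same formula, so that the loci are parametrized by it without exception.\<close>

lemma Omega_first_brocard:
  assumes a: "a > 0" "x1 \<noteq> - a"
  shows "\<not> degenerate a x1 t \<Longrightarrow> is_brocard1 (vertex1 x1) (vertex2 a) (vertex3 a t) P \<longleftrightarrow>
      P = first_brocard (vertex1 x1) (vertex2 a) (vertex3 a t)"
    and "\<not> degenerate a x1 t \<Longrightarrow> is_brocard2 (vertex1 x1) (vertex2 a) (vertex3 a t) P \<longleftrightarrow>
      P = first_brocard (vertex2 a) (vertex1 x1) (vertex3 a t)"
    and "degenerate a x1 t \<Longrightarrow> (brocard_pt1 a x1 \<longlongrightarrow> first_brocard (vertex1 x1) (vertex2 a) (vertex3 a t)) (at t)"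
    and "degenerate a x1 t \<Longrightarrow> (brocard_pt2 a x1 \<longlongrightarrow> first_brocard (vertex2 a) (vertex1 x1) (vertex3 a t)) (at t)"
    and "Omega1 a x1 t = first_brocard (vertex1 x1) (vertex2 a) (vertex3 a t)"
    and "Omega2 a x1 t = first_brocard (vertex2 a) (vertex1 x1) (vertex3 a t)"
proof -
  have b1: "is_brocard1 (vertex1 x1) (vertex2 a) (vertex3 a s) P \<longleftrightarrow>
      P = first_brocard (vertex1 x1) (vertex2 a) (vertex3 a s)" if "\<not> degenerate a x1 s" for s P
    using that is_brocard1_iff unfolding degenerate_def by blast
  have b2: "is_brocard2 (vertex1 x1) (vertex2 a) (vertex3 a s) P \<longleftrightarrow>
      P = first_brocard (vertex2 a) (vertex1 x1) (vertex3 a s)" if "\<not> degenerate a x1 s" for s P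
    using that is_brocard1_iff[of "vertex2 a" "vertex1 x1" "vertex3 a s"]
    unfolding degenerate_def is_brocard2_iff_swap insert_commute[of "vertex1 x1" "vertex2 a"] by blast
  have e: "\<forall>\<^sub>F s in at t. \<not> degenerate a x1 s"
    using eventually_sin_nonzero degenerate_iff[OF a] by simp
  have ne: "vertex1 x1 \<noteq> vertex2 a" using a by (simp add: vertex1_def vertex2_def)
  have p1: "brocard_pt1 a x1 s = first_brocard (vertex1 x1) (vertex2 a) (vertex3 a s)"
    if "\<not> degenerate a x1 s" for s
    unfolding brocard_pt1_def b1[OF that] by simp
  have p2: "brocard_pt2 a x1 s = first_brocard (vertex2 a) (vertex1 x1) (vertex3 a s)"
    if "\<not> degenerate a x1 s" for s
    unfolding brocard_pt2_def b2[OF that] by simp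
  have l1: "(brocard_pt1 a x1 \<longlongrightarrow> first_brocard (vertex1 x1) (vertex2 a) (vertex3 a t)) (at t)"
    by (rule Lim_transform_eventually[OF tendsto_first_brocard_vertex3[OF ne]])
      (use e in \<open>auto elim: eventually_mono simp: p1\<close>)
  have l2: "(brocard_pt2 a x1 \<longlongrightarrow> first_brocard (vertex2 a) (vertex1 x1) (vertex3 a t)) (at t)"
    by (rule Lim_transform_eventually[OF tendsto_first_brocard_vertex3[OF ne[symmetric]]])
      (use e in \<open>auto elim: eventually_mono simp: p2\<close>)
  show "\<not> degenerate a x1 t \<Longrightarrow> is_brocard1 (vertex1 x1) (vertex2 a) (vertex3 a t) P \<longleftrightarrow>
      P = first_brocard (vertex1 x1) (vertex2 a) (vertex3 a t)" by (rule b1)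
  show "\<not> degenerate a x1 t \<Longrightarrow> is_brocard2 (vertex1 x1) (vertex2 a) (vertex3 a t) P \<longleftrightarrow>
      P = first_brocard (vertex2 a) (vertex1 x1) (vertex3 a t)" by (rule b2)
  show "(brocard_pt1 a x1 \<longlongrightarrow> first_brocard (vertex1 x1) (vertex2 a) (vertex3 a t)) (at t)" by (rule l1)
  show "(brocard_pt2 a x1 \<longlongrightarrow> first_brocard (vertex2 a) (vertex1 x1) (vertex3 a t)) (at t)" by (rule l2)
  show "Omega1 a x1 t = first_brocard (vertex1 x1) (vertex2 a) (vertex3 a t)"
    unfolding Omega1_def using p1 tendsto_Lim[OF _ l1] by simp
  show "Omega2 a x1 t = first_brocard (vertex2 a) (vertex1 x1) (vertex3 a t)"
    unfolding Omega2_def using p2 tendsto_Lim[OF _ l2] by simp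
qed

lemma path_image_revolution:
  assumes "\<Omega> (2 * pi) = \<Omega> 0"
  shows "path_image (revolution \<Omega>) = locus \<Omega>"
proof -
  have "path_image (revolution \<Omega>) = \<Omega> ` {0..2 * pi}"
    unfolding path_image_def revolution_def image_comp[symmetric]
    using linepath_image_01[of 0 "2 * pi"] by (simp add: closed_segment_eq_real_ivl)
  also have "{0..2 * pi} = insert (2 * pi) {0..<2 * pi}" by auto
  finally show ?thesis
    using assms by (auto simp: locus_def intro!: image_eqI[of _ _ 0])
qed

section \<open>The loci as rational curves\<close>

text \<open>Measuring the abscissa of the first vertex in units of the radius makes \<open>a\<close> a mere scaling factor
  of the loci.\<close>

lemma point_of_vertices:
  "vertex1 (a * x) = point_of (of_real a * of_real x)" "vertex2 a = point_of (- of_real a)"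
  "vertex3 a t = point_of (of_real a * cis t)"
  by (simp_all add: point_of_def vertex1_def vertex2_def vertex3_def)

text \<open>On the unit circle, \<^term>\<open>cnj z\<close> is \<open>1 / z\<close>, which makes the formula
  for the Brocard point rational in \<open>z\<close>.\<close>

lemma first_brocard_rational:
  fixes a x t :: real
  assumes "a > 0" "x > - 1"
  defines "z \<equiv> cis t"
  shows "first_brocard (vertex1 (a * x)) (vertex2 a) (vertex3 a t) = point_of (- of_real a +
     of_real a * (1 + of_real x) * (1 + z)^2 / (1 + (2 + of_real x + of_real x^2) * z - of_real x * z^2))"
proof -
  define X where "X = complex_of_real x"
  define c where "c = complex_of_real a"
  have c: "c \<noteq> 0" using assms by (simp add: c_def)
  have cc[simp]: "cnj X = X" "cnj c = c" by (simp_all add: X_def c_def)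
  have z0: "z \<noteq> 0" by (simp add: z_def)
  have cz: "cnj z = 1 / z" by (simp add: z_def cis_cnj cis_inverse divide_inverse)
  define P where "P = 1 + (2 + X + X^2) * z - X * z^2"
  have "X \<noteq> -1" using assms unfolding X_def by (metis less_irrefl of_real_eq_iff of_real_minus of_real_1)
  then have ne: "c * X \<noteq> - c" using c by (metis mult.right_neutral mult_minus_right mult_left_cancel)
  define u where "u = c * z - - c"
  define v where "v = c * X - - c"
  define Q where "Q = u * cnj u + v * cnj v - u * cnj v"
  have Q: "Q = c^2 * P / z"
    unfolding Q_def u_def v_def P_def using z0 by (simp add: cz field_simps power2_eq_square)
  have "Q \<noteq> 0"
    using first_brocard_point_of(1)[OF ne, of "c * z"] by (simp add: Q_def u_def v_def)
  with Q have P: "P \<noteq> 0" by auto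
  have uu: "v * (u * cnj u) = c^3 * (1 + X) * (1 + z)^2 / z"
    unfolding u_def v_def using z0 by (simp add: cz field_simps power2_eq_square power3_eq_cube)
  have "v * (u * cnj u) / Q = c * (1 + X) * (1 + z)^2 / P"
    unfolding uu Q using z0 c P by (simp add: power2_eq_square power3_eq_cube)
  then have "point_of (- c + v * (u * cnj u) / Q) = point_of (- c + c * (1 + X) * (1 + z)^2 / P)"
    by simp
  then show ?thesis
    using first_brocard_point_of(2)[OF ne, of "c * z"]
    unfolding point_of_vertices Q_def u_def v_def P_def X_def c_def z_def by simp
qed

lemma second_brocard_rational:
  fixes a x t :: real
  assumes "a > 0" "x > - 1"
  defines "z \<equiv> cis t"
  shows "first_brocard (vertex2 a) (vertex1 (a * x)) (vertex3 a t) = point_of (of_real a * of_real x -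
     of_real a * (1 + of_real x) * ((z - of_real x) * (1 - of_real x * z))
     / (z^2 + (2 + of_real x + of_real x^2) * z - of_real x))"
proof -
  define X where "X = complex_of_real x"
  define c where "c = complex_of_real a"
  have c: "c \<noteq> 0" using assms by (simp add: c_def)
  have cc[simp]: "cnj X = X" "cnj c = c" by (simp_all add: X_def c_def)
  have z0: "z \<noteq> 0" by (simp add: z_def)
  have cz: "cnj z = 1 / z" by (simp add: z_def cis_cnj cis_inverse divide_inverse)
  define P where "P = z^2 + (2 + X + X^2) * z - X"
  have "X \<noteq> -1" using assms unfolding X_def by (metis less_irrefl of_real_eq_iff of_real_minus of_real_1)
  then have ne: "- c \<noteq> c * X" using c by (metis mult.right_neutral mult_minus_right mult_left_cancel)
  define u where "u = c * z - c * X"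
  define v where "v = - c - c * X"
  define Q where "Q = u * cnj u + v * cnj v - u * cnj v"
  have Q: "Q = c^2 * P / z"
    unfolding Q_def u_def v_def P_def using z0 by (simp add: cz field_simps power2_eq_square)
  have "Q \<noteq> 0"
    using first_brocard_point_of(1)[OF ne, of "c * z"] by (simp add: Q_def u_def v_def)
  with Q have P: "P \<noteq> 0" by auto
  have uu: "v * (u * cnj u) = - (c^3 * (1 + X) * ((z - X) * (1 - X * z)) / z)"
    unfolding u_def v_def using z0 by (simp add: cz field_simps power2_eq_square power3_eq_cube)
  have "v * (u * cnj u) / Q = - (c * (1 + X) * ((z - X) * (1 - X * z)) / P)"
    unfolding uu Q using z0 c P by (simp add: power2_eq_square power3_eq_cube)
  then have "point_of (c * X + v * (u * cnj u) / Q) =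
      point_of (c * X - c * (1 + X) * ((z - X) * (1 - X * z)) / P)"
    by simp
  then show ?thesis
    using first_brocard_point_of(2)[OF ne, of "c * z"]
    unfolding point_of_vertices Q_def u_def v_def P_def X_def c_def z_def by simp
qed

section \<open>Poles and areas\<close>

text \<open>The quadratic \<open>1 + p z - x z\<^sup>2\<close> with \<open>p = 2 + x + x\<^sup>2\<close> is the denominator for the first Brocard
  point and its reversal \<open>z\<^sup>2 + p z - x\<close> the one for the second. Its
  discriminant is \<open>p\<^sup>2 + 4 x = (1 + x)\<^sup>2 (4 + x\<^sup>2)\<close>, whence the square root in the areas. Its root \<open>q\<close> lies inside the
  unit circle and its other root is \<open>1 / \<rho>\<close>, outside (at infinity for \<open>x = 0\<close>). For the reversed quadratic the
  roots are \<open>\<rho>\<close> and \<open>1 / q\<close>, so the two cases only exchange \<open>\<rho>\<close> and \<open>q\<close>.\<close>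

lemma brocard_poles:
  fixes x :: real
  assumes x: "- 1 < x" "x \<le> 1"
  obtains \<rho> q :: real where "- 1 < q" "q < 0" "\<bar>\<rho>\<bar> < 1" "\<rho> = - x * q"
    "1 + (2 + x + x^2) * q - x * q^2 = 0"
    "1 - \<rho> * q = - q * ((1 + x) * sqrt (4 + x^2))"
    "(1 - \<rho>) * (1 - q) = - q * (3 + x^2)"
proof -
  define p where "p = 2 + x + x^2"
  define d where "d = (1 + x) * sqrt (4 + x^2)"
  \<comment> \<open>The rationalized form of \<open>(p - d) / (2 x)\<close>, which also makes sense for \<open>x = 0\<close>.\<close>
  define q where "q = - 2 / (p + d)"
  define \<rho> where "\<rho> = - x * q"
  have "d > 0" using x by (simp add: d_def add_pos_nonneg)
  have "sqrt (4 + x^2) \<ge> 2" by (rule real_le_rsqrt) simp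
  then have "(1 + x) * 2 \<le> d" unfolding d_def using x by (intro mult_left_mono) auto
  then have "2 + 2 * x \<le> d" by simp
  moreover have "(1 + x) * (2 + x) > 0" using x by simp
  then have "2 + 3 * x + x^2 > 0" by (simp add: algebra_simps power2_eq_square)
  ultimately have w: "p + d > 2" unfolding p_def by linarith
  then have q: "- 1 < q" "q < 0" "q * (p + d) = - 2" by (simp_all add: q_def field_simps)
  have "d^2 = (1 + x)^2 * (4 + x^2)" by (simp add: d_def power_mult_distrib)
  then have d2: "d^2 = p^2 + 4 * x" unfolding p_def by algebra
  have eq: "1 + p * q - x * q^2 = 0"
    using q(3) d2 by algebra
  have \<rho>q: "1 - \<rho> * q = - q * d"
    using q(3) eq unfolding \<rho>_def by algebra
  have m: "(1 - \<rho>) * (1 - q) = - q * (3 + x^2)"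
    using eq unfolding \<rho>_def p_def by algebra
  have "\<bar>\<rho>\<bar> = \<bar>x\<bar> * \<bar>q\<bar>" by (simp add: \<rho>_def abs_mult)
  also have "\<dots> \<le> 1 * \<bar>q\<bar>" using x by (intro mult_right_mono) auto
  also have "\<dots> < 1" using q by simp
  finally have "\<bar>\<rho>\<bar> < 1" .
  show ?thesis
    using that[OF q(1,2) \<open>\<bar>\<rho>\<bar> < 1\<close> \<rho>_def eq[unfolded p_def] \<rho>q[unfolded d_def] m] .
qed

text \<open>The quadratic numerator is \<open>(1 + z)\<^sup>2\<close>, so the area is a multiple of the difference of the squares of
  \<open>(1 + \<rho>) / (1 - \<rho>)\<close> and \<open>(1 + q) / (1 - q)\<close>. This difference is
  \<open>4 (\<rho> - q) (1 - \<rho> q) / ((1 - \<rho>) (1 - q))\<^sup>2\<close>. Each of \<open>\<rho> - q\<close>, \<open>1 - \<rho> q\<close> and \<open>(1 - \<rho>) (1 - q)\<close> is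
  \<open>- q\<close> times an expression in \<open>x\<close>, and the powers of \<open>q\<close> cancel.\<close>

lemma Omega1_curve:
  fixes a x :: real
  assumes a: "a > 0" and x: "- 1 < x" "x \<le> 1"
    and g: "\<And>s. g s = first_brocard (vertex1 (a * x)) (vertex2 a) (vertex3 a (2 * pi * s))"
  shows "valid_path g" "closed_path g"
    "curve_area g = 4 * a^2 * (1 + x)^2 * pi / ((3 + x^2)^2 * sqrt (4 + x^2))"
proof -
  obtain \<rho> q where q: "- 1 < q" "q < 0" and \<rho>: "\<bar>\<rho>\<bar> < 1" "\<rho> = - x * q"
    and eq: "1 + (2 + x + x^2) * q - x * q^2 = 0"
    and k: "1 - \<rho> * q = - q * ((1 + x) * sqrt (4 + x^2))"
    and m: "(1 - \<rho>) * (1 - q) = - q * (3 + x^2)"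
    using brocard_poles[OF x] by metis
  have q1: "\<bar>q\<bar> < 1" using q by simp
  have d: "\<rho> - q = - q * (1 + x)" using \<rho>(2) by (simp add: algebra_simps)
  then have ne: "\<rho> \<noteq> q" using q x by auto
  define f where "f = (\<lambda>z::complex. - of_real a + of_real a * (1 + of_real x) * (1 + z)^2 /
      (1 + (2 + of_real x + of_real x^2) * z - of_real x * z^2))"
  define K where "K = - (a * (1 + x) * q)"
  have f: "f z = of_real (- a) + of_real K *
        ((of_real 1 + of_real 2 * z + of_real 1 * z^2) / ((1 - of_real \<rho> * z) * (z - of_real q)))"
    for z
  proof -
    define X where "X = complex_of_real x"
    define c where "c = complex_of_real q"
    have c: "c \<noteq> 0" using q by (simp add: c_def)
    have "of_real (1 + (2 + x + x^2) * q - x * q^2) = (0 :: complex)" unfolding eq by simp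
    then have e: "1 + (2 + X + X^2) * c - X * c^2 = 0" by (simp add: X_def c_def)
    have "(1 + X * c * z) * (z - c) = - c * (1 + (2 + X + X^2) * z - X * z^2)"
      using e by algebra
    moreover have "of_real \<rho> = - (X * c)" by (simp add: \<rho>(2) X_def c_def)
    ultimately have "(1 - of_real \<rho> * z) * (z - of_real q) = - c * (1 + (2 + X + X^2) * z - X * z^2)"
      by (simp add: c_def)
    then show ?thesis
      unfolding f_def using c
      by (simp add: K_def X_def[symmetric] c_def[symmetric] power2_sum)
  qed
  have g': "g s = point_of (f (cis (2 * pi * s)))" for s
    unfolding g f_def using first_brocard_rational[OF a x(1)] by simp
  note * = quadratic_fraction_curve_area[where l = 1 and m = 2 and n = 1 and f = f and g = g,
      OF \<rho>(1) q1 ne f g']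
  show "valid_path g" "closed_path g" using * by auto
  define S where "S = sqrt (4 + x^2)"
  have S: "S > 0" by (simp add: S_def add_pos_nonneg)
  have nz: "1 - \<rho> \<noteq> 0" "1 + \<rho> \<noteq> 0" "1 - q \<noteq> 0" "1 + q \<noteq> 0" using q \<rho>(1) by auto
  have cancel: "(1 + 2 * r + 1 * r^2) / (1 - r^2) = (1 + r) / (1 - r)"
    if "1 - r \<noteq> 0" "1 + r \<noteq> 0" for r :: real
  proof -
    have "1 + 2 * r + 1 * r^2 = (1 + r) * (1 + r)" "1 - r^2 = (1 - r) * (1 + r)"
      by algebra+
    then show ?thesis using that by simp
  qed
  then have "curve_area g = pi * (K / (1 - \<rho> * q))^2 *
      \<bar>((1 + \<rho>) / (1 - \<rho>))^2 - ((1 + q) / (1 - q))^2\<bar>"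
    using *(3) by (simp only: cancel nz not_False_eq_True)
  also have "((1 + \<rho>) / (1 - \<rho>))^2 - ((1 + q) / (1 - q))^2 =
     4 * (\<rho> - q) * (1 - \<rho> * q) / ((1 - \<rho>) * (1 - q))^2"
  proof -
    have "(1 + \<rho>)^2 * (1 - q)^2 - (1 + q)^2 * (1 - \<rho>)^2 = 4 * (\<rho> - q) * (1 - \<rho> * q)"
      by algebra
    then show ?thesis
      using nz by (simp add: power_divide power_mult_distrib diff_frac_eq)
  qed
  also have "\<dots> = 4 * (1 + x)^2 * S / (3 + x^2)^2"
    unfolding d k m S_def[symmetric] using q x by (simp add: power2_eq_square)
  also have "\<bar>\<dots>\<bar> = 4 * (1 + x)^2 * S / (3 + x^2)^2"
    using S by simp
  also have "K / (1 - \<rho> * q) = a / S"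
    unfolding k K_def S_def[symmetric] using q x by simp
  finally show "curve_area g = 4 * a^2 * (1 + x)^2 * pi / ((3 + x^2)^2 * sqrt (4 + x^2))"
    unfolding S_def[symmetric] using S by (simp add: power2_eq_square mult_ac)
qed

text \<open>The quadratic numerator is \<open>(z - x) (1 - x z)\<close>. At \<open>q\<close> and \<open>\<rho>\<close> the quadratic equation
  reduces it to a multiple of \<open>1 + q\<close> or \<open>1 + \<rho>\<close>, which
  cancels against the denominators of the area formula.\<close>

lemma Omega2_curve:
  fixes a x :: real
  assumes a: "a > 0" and x: "- 1 < x" "x \<le> 1"
    and g: "\<And>s. g s = first_brocard (vertex2 a) (vertex1 (a * x)) (vertex3 a (2 * pi * s))"
  shows "valid_path g" "closed_path g"
    "curve_area g = (2 - x + x^2) * (1 + x)^3 * a^2 * pi / ((3 + x^2)^2 * sqrt (4 + x^2))"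
proof -
  obtain \<rho> q where q: "- 1 < q" "q < 0" and \<rho>: "\<bar>\<rho>\<bar> < 1" "\<rho> = - x * q"
    and eq: "1 + (2 + x + x^2) * q - x * q^2 = 0"
    and k: "1 - \<rho> * q = - q * ((1 + x) * sqrt (4 + x^2))"
    and m: "(1 - \<rho>) * (1 - q) = - q * (3 + x^2)"
    using brocard_poles[OF x] by metis
  have q1: "\<bar>q\<bar> < 1" using q by simp
  have "\<rho> - q = - q * (1 + x)" using \<rho>(2) by (simp add: algebra_simps)
  then have ne: "q \<noteq> \<rho>" using q x by auto
  define f where "f = (\<lambda>z::complex. of_real a * of_real x -
     of_real a * (1 + of_real x) * ((z - of_real x) * (1 - of_real x * z))
     / (z^2 + (2 + of_real x + of_real x^2) * z - of_real x))"
  define K where "K = a * (1 + x) * q"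
  have f: "f z = of_real (a * x) + of_real K *
        ((of_real (- x) + of_real (1 + x^2) * z + of_real (- x) * z^2)
          / ((1 - of_real q * z) * (z - of_real \<rho>)))"
    for z
  proof -
    define X where "X = complex_of_real x"
    define c where "c = complex_of_real q"
    have c: "c \<noteq> 0" using q by (simp add: c_def)
    have "of_real (1 + (2 + x + x^2) * q - x * q^2) = (0 :: complex)" unfolding eq by simp
    then have e: "1 + (2 + X + X^2) * c - X * c^2 = 0" by (simp add: X_def c_def)
    have "(1 - c * z) * (z + X * c) = - c * (z^2 + (2 + X + X^2) * z - X)"
      using e by algebra
    moreover have "of_real \<rho> = - (X * c)" by (simp add: \<rho>(2) X_def c_def)
    ultimately have "(1 - of_real q * z) * (z - of_real \<rho>) = - c * (z^2 + (2 + X + X^2) * z - X)"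
      by (simp add: c_def)
    moreover have "of_real (- x) + of_real (1 + x^2) * z + of_real (- x) * z^2 = (z - X) * (1 - X * z)"
      by (simp add: X_def algebra_simps power2_eq_square)
    ultimately show ?thesis
      unfolding f_def using c
      by (simp add: K_def X_def[symmetric] c_def[symmetric])
  qed
  have g': "g s = point_of (f (cis (2 * pi * s)))" for s
    unfolding g f_def using second_brocard_rational[OF a x(1)] by simp
  note * = quadratic_fraction_curve_area[where l = "- x" and m = "1 + x^2" and n = "- x"
      and f = f and g = g, OF q1 \<rho>(1) ne f g']
  show "valid_path g" "closed_path g" using * by auto
  define S where "S = sqrt (4 + x^2)"
  have S: "S > 0" by (simp add: S_def add_pos_nonneg)
  have nz: "1 - \<rho> \<noteq> 0" "1 + \<rho> \<noteq> 0" "1 - q \<noteq> 0" "1 + q \<noteq> 0" using q \<rho>(1) by auto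
  have "- x + (1 + x^2) * q + - x * q^2 = - (1 + x) * (1 + q)"
    using eq by algebra
  moreover have "- x + (1 + x^2) * \<rho> + - x * \<rho>^2 = - (1 + x) * \<rho> * (1 + \<rho>)"
    using eq unfolding \<rho>(2) by algebra
  moreover have "1 - q^2 = (1 - q) * (1 + q)" "1 - \<rho>^2 = (1 - \<rho>) * (1 + \<rho>)"
    by (simp_all add: power2_eq_square algebra_simps)
  ultimately have "(- x + (1 + x^2) * q + - x * q^2) / (1 - q^2) = - (1 + x) / (1 - q)"
    "(- x + (1 + x^2) * \<rho> + - x * \<rho>^2) / (1 - \<rho>^2) = - (1 + x) * \<rho> / (1 - \<rho>)"
    using nz by simp_all
  then have "curve_area g = pi * (K / (1 - \<rho> * q))^2 *
      \<bar>(- (1 + x) / (1 - q))^2 - (- (1 + x) * \<rho> / (1 - \<rho>))^2\<bar>"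
    using *(3) by (simp add: mult.commute[of q \<rho>])
  also have "(- (1 + x) / (1 - q))^2 - (- (1 + x) * \<rho> / (1 - \<rho>))^2 =
     (1 + x)^2 * (1 - 2 * \<rho> + \<rho> * q) * (1 - \<rho> * q) / ((1 - \<rho>) * (1 - q))^2"
  proof -
    have "(- (1 + x))^2 * (1 - \<rho>)^2 - (- (1 + x) * \<rho>)^2 * (1 - q)^2 =
       (1 + x)^2 * (1 - 2 * \<rho> + \<rho> * q) * (1 - \<rho> * q)"
      by algebra
    then show ?thesis
      using nz unfolding power_divide by (subst diff_frac_eq) (simp_all add: power_mult_distrib mult.commute)
  qed
  also have "1 - 2 * \<rho> + \<rho> * q = - q * (2 - x + x^2)"
    using eq unfolding \<rho>(2) by algebra
  also have "(1 + x)^2 * (- q * (2 - x + x^2)) * (1 - \<rho> * q) / ((1 - \<rho>) * (1 - q))^2 =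
      (1 + x)^3 * (2 - x + x^2) * S / (3 + x^2)^2"
    unfolding k m S_def[symmetric] using q x by (simp add: power2_eq_square power3_eq_cube)
  also have "\<bar>\<dots>\<bar> = (1 + x)^3 * (2 - x + x^2) * S / (3 + x^2)^2"
  proof -
    have "2 - x + x^2 \<ge> 0" using x by (intro add_nonneg_nonneg) auto
    then show ?thesis using S x by simp
  qed
  also have "K / (1 - \<rho> * q) = - (a / S)"
    unfolding k K_def S_def[symmetric] using q x by simp
  finally show "curve_area g = (2 - x + x^2) * (1 + x)^3 * a^2 * pi / ((3 + x^2)^2 * sqrt (4 + x^2))"
    unfolding S_def[symmetric] using S by (simp add: power2_eq_square mult_ac)
qed

theorem proposition4:
  fixes a x1 :: real
  assumes "a > 0" and "- a < x1" and "x1 \<le> a"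
  shows
    "finite {t \<in> {0..<2 * pi}. degenerate a x1 t} \<and>
     (\<forall>t. \<not> degenerate a x1 t \<longrightarrow>
        (\<exists>!P. is_brocard1 (vertex1 x1) (vertex2 a) (vertex3 a t) P) \<and>
        (\<exists>!P. is_brocard2 (vertex1 x1) (vertex2 a) (vertex3 a t) P)) \<and>
     (\<forall>t. degenerate a x1 t \<longrightarrow>
        (brocard_pt1 a x1 \<longlongrightarrow> Omega1 a x1 t) (at t) \<and>
        (brocard_pt2 a x1 \<longlongrightarrow> Omega2 a x1 t) (at t)) \<and>
     valid_path (revolution (Omega1 a x1)) \<and>
     closed_path (revolution (Omega1 a x1)) \<and>
     path_image (revolution (Omega1 a x1)) = locus (Omega1 a x1) \<and>
     curve_area (revolution (Omega1 a x1)) =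
       4 * (x1 + a)^2 * a^5 * pi / ((3 * a^2 + x1^2)^2 * sqrt (4 * a^2 + x1^2)) \<and>
     valid_path (revolution (Omega2 a x1)) \<and>
     closed_path (revolution (Omega2 a x1)) \<and>
     path_image (revolution (Omega2 a x1)) = locus (Omega2 a x1) \<and>
     curve_area (revolution (Omega2 a x1)) =
       (2 * a^2 - a * x1 + x1^2) * (x1 + a)^3 * a^2 * pi /
       ((3 * a^2 + x1^2)^2 * sqrt (4 * a^2 + x1^2))"
proof -
  note a = \<open>a > 0\<close>
  have ne: "x1 \<noteq> - a" using assms by simp
  define x where "x = x1 / a"
  have x1: "x1 = a * x" using a by (simp add: x_def)
  have x: "- 1 < x" "x \<le> 1" using assms by (simp_all add: x_def field_simps)
  note Om = Omega_first_brocard[OF a ne]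
  have "t = 0 \<or> t = pi" if "0 \<le> t" "t < 2 * pi" "sin t = 0" for t
    using that sin_gt_zero[of t] sin_lt_zero[of t] by argo
  then have "{t \<in> {0..<2 * pi}. degenerate a x1 t} \<subseteq> {0, pi}"
    by (auto simp only: degenerate_iff[OF a ne] atLeastLessThan_iff)
  then have fin: "finite {t \<in> {0..<2 * pi}. degenerate a x1 t}"
    by (rule finite_subset) simp
  have rev: "revolution \<Omega> s = \<Omega> (2 * pi * s)" for \<Omega> s
    by (simp add: revolution_def linepath_def mult.commute)
  have per: "Omega1 a x1 (2 * pi) = Omega1 a x1 0" "Omega2 a x1 (2 * pi) = Omega2 a x1 0"
    unfolding Om(5,6) by (simp_all add: vertex3_def)
  have scale: "(3 * a^2 + x1^2)^2 = a^4 * (3 + x^2)^2" "sqrt (4 * a^2 + x1^2) = a * sqrt (4 + x^2)"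
    "(x1 + a)^2 = a^2 * (1 + x)^2" "(x1 + a)^3 = a^3 * (1 + x)^3"
    "2 * a^2 - a * x1 + x1^2 = a^2 * (2 - x + x^2)"
  proof -
    have "4 * a^2 + x1^2 = a^2 * (4 + x^2)" by (simp add: x1 algebra_simps power2_eq_square)
    then show "sqrt (4 * a^2 + x1^2) = a * sqrt (4 + x^2)" using a by (simp add: real_sqrt_mult)
  qed (unfold x1, algebra+)
  have "revolution (Omega1 a x1) s = first_brocard (vertex1 (a * x)) (vertex2 a) (vertex3 a (2 * pi * s))"
    for s
    using Om(5) by (simp only: rev flip: x1)
  note curve1 = Omega1_curve[OF a x this]
  have "revolution (Omega2 a x1) s = first_brocard (vertex2 a) (vertex1 (a * x)) (vertex3 a (2 * pi * s))"
    for s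
    using Om(6) by (simp only: rev flip: x1)
  note curve2 = Omega2_curve[OF a x this]
  have area1: "curve_area (revolution (Omega1 a x1)) =
       4 * (x1 + a)^2 * a^5 * pi / ((3 * a^2 + x1^2)^2 * sqrt (4 * a^2 + x1^2))"
    unfolding curve1(3) scale using a by (simp add: power_numeral_reduce mult_ac)
  have area2: "curve_area (revolution (Omega2 a x1)) =
       (2 * a^2 - a * x1 + x1^2) * (x1 + a)^3 * a^2 * pi /
       ((3 * a^2 + x1^2)^2 * sqrt (4 * a^2 + x1^2))"
    unfolding curve2(3) scale using a by (simp add: power_numeral_reduce mult_ac)
  have unique: "(\<exists>!P. is_brocard1 (vertex1 x1) (vertex2 a) (vertex3 a t) P) \<and>
        (\<exists>!P. is_brocard2 (vertex1 x1) (vertex2 a) (vertex3 a t) P)" if "\<not> degenerate a x1 t" for t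
    unfolding Om(1)[OF that] Om(2)[OF that] by blast
  have limits: "(brocard_pt1 a x1 \<longlongrightarrow> Omega1 a x1 t) (at t) \<and>
        (brocard_pt2 a x1 \<longlongrightarrow> Omega2 a x1 t) (at t)" if "degenerate a x1 t" for t
    unfolding Om(5,6) using Om(3,4)[OF that] by blast
  show ?thesis
    by (intro conjI allI impI fin unique limits curve1(1,2) curve2(1,2) area1 area2
        path_image_revolution per)
qed

end
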